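(* Let $T(z)=\frac{1-\sqrt{1-4z}}{2}$. The bivariate generating function $S(z,t)$ of the class $\mathcal{S}$ of Catalan--Stanley trees, in which $t$ marks the rightmost leaves of the branches attached to the root and $z$ marks all other nodes, is \[ S(z,t) = z + \frac{zt}{1-t-T(z)^{2}}. \] In particular, there is exactly one Catalan--Stanley tree of size $1$, and for $n\ge 2$ the number of Catalan--Stanley trees of size $n$ (number of nodes) is the Catalan number $C_{n-2}=\frac{1}{n-1}\binom{2n-4}{n-2}$.
   Context: A rooted plane tree is a rooted tree in which the children of every node are linearly ordered. For a rooted plane tree $\tau$ whose root has children $c_1,\dots,c_k$, the "branch attached to the root" at $c_i$ is the subtree rooted at $c_i$, and its rightmost leaf is the leaf reached from $c_i$ by repeatedly moving to the last (rightmost) child. A Catalan--Stanley tree is a rooted plane tree in which, for each branch attached to the root, the distance from the root to the rightmost leaf of that branch is odd; the tree consisting of the root alone is also a Catalan--Stanley tree. $\mathcal{S}$ denotes the class of all Catalan--Stanley trees. $T(z)=\frac{1-\sqrt{1-4z}}{2}$ is the generating function of rooted plane trees by number of nodes and satisfies $T=z+T^2$. In $S(z,t)$, the coefficient of $z^a t^b$ counts Catalan--Stanley trees with $b$ such rightmost leaves (equivalently $b$ children of the root) and $a$ other nodes (the root included among the $z$-nodes). *)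

theory Defs
  imports Complex_Main "HOL-Computational_Algebra.Formal_Power_Series"
begin

datatype plane_tree = Node (children: "plane_tree list")

text \<open>
  A node is addressed by the path leading to it from the root, i.e. the list of (0-based)
  positions of the children chosen along the way. Hence the distance of a node from the root
  is the length of its address.
\<close>

inductive is_node :: "plane_tree \<Rightarrow> nat list \<Rightarrow> bool" where
  root: "is_node \<tau> []"
| child: "i < length (children \<tau>) \<Longrightarrow> is_node (children \<tau> ! i) p \<Longrightarrow> is_node \<tau> (i # p)"

definition nodes :: "plane_tree \<Rightarrow> nat list set" where
  "nodes \<tau> = {p. is_node \<tau> p}"

function rightmost_leaf :: "plane_tree \<Rightarrow> nat list" where
  "rightmost_leaf (Node ts) =
     (if ts = [] then [] else (length ts - 1) # rightmost_leaf (last ts))"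
  by pat_completeness auto
termination
  by (relation "measure size") (auto simp: less_Suc_eq_le intro: size_list_estimation'[OF last_in_set])

text \<open>The addresses, in the whole tree, of the rightmost leaves of the branches at the root.\<close>

definition branch_leaves :: "plane_tree \<Rightarrow> nat list set" where
  "branch_leaves \<tau> = {i # rightmost_leaf (children \<tau> ! i) | i. i < length (children \<tau>)}"

definition catalan_stanley :: "plane_tree \<Rightarrow> bool" where
  "catalan_stanley \<tau> \<longleftrightarrow> (\<forall>p \<in> branch_leaves \<tau>. odd (length p))"

definition T_gf :: "real fps" where
  "T_gf = (1 - fps_radical root 2 (1 - 4 * fps_X)) / 2"

text \<open>
  A bivariate series in \<open>z\<close> and \<open>t\<close> is a power series in \<open>t\<close> whose coefficients are power
  series in \<open>z\<close>, so the coefficient of \<open>z\<^sup>a t\<^sup>b\<close> in \<open>F\<close> is \<open>fps_nth (fps_nth F b) a\<close>.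
\<close>

abbreviation var_t :: "real fps fps" where
  "var_t \<equiv> fps_X"

abbreviation var_z :: "real fps fps" where
  "var_z \<equiv> fps_const fps_X"

definition S_gf :: "real fps fps" where
  "S_gf = Abs_fps (\<lambda>b. Abs_fps (\<lambda>a.
     real (card {\<tau>. catalan_stanley \<tau> \<and> card (branch_leaves \<tau>) = b \<and>
                     card (nodes \<tau> - branch_leaves \<tau>) = a})))"

end

theory Submission
  imports Defs
begin

text \<open>
  Cut a tree along the path from its root to its rightmost leaf: every inner node of the path,
  together with the subtrees hanging off to its left, is again a plane tree and contributes a
  factor \<open>T\<close>. A branch whose rightmost leaf is at even depth below the root of the branch
  therefore has the generating function \<open>E = 1 / (1 - T\<^sup>2)\<close> once that leaf is left uncounted, and
  the Catalan--Stanley trees whose root has \<open>b\<close> children are counted by \<open>z E\<^sup>b\<close>. Counting all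
  nodes gives \<open>z / (1 - z E)\<close>, which collapses to \<open>z (1 + T)\<close> because \<open>T = z + T\<^sup>2\<close>.
\<close>

section \<open>Generating functions of weighted classes\<close>

text \<open>Guards against the default \<open>card = 0\<close> of infinite sets, under which the sum
  and product rules would fail.\<close>

definition finite_fibres :: "'a set \<Rightarrow> ('a \<Rightarrow> nat) \<Rightarrow> bool" where
  "finite_fibres A w \<longleftrightarrow> (\<forall>n. finite {x \<in> A. w x = n})"

definition class_gf :: "'a set \<Rightarrow> ('a \<Rightarrow> nat) \<Rightarrow> real fps" where
  "class_gf A w = Abs_fps (\<lambda>n. real (card {x \<in> A. w x = n}))"

lemma class_gf_nth [simp]: "fps_nth (class_gf A w) n = real (card {x \<in> A. w x = n})"
  by (simp add: class_gf_def)

lemma finite_fibres_subset: "finite_fibres B w \<Longrightarrow> A \<subseteq> B \<Longrightarrow> finite_fibres A w"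
  by (auto simp: finite_fibres_def intro: rev_finite_subset)

lemma class_gf_cong: "(\<And>x. x \<in> A \<Longrightarrow> w x = v x) \<Longrightarrow> class_gf A w = class_gf A v"
  by (simp add: class_gf_def cong: conj_cong)

lemma fibre_image:
  assumes "\<And>x. x \<in> A \<Longrightarrow> w (f x) = v x"
  shows "{y \<in> f ` A. w y = n} = f ` {x \<in> A. v x = n}"
  using assms by auto

lemma finite_fibres_image:
  assumes "finite_fibres A v" "\<And>x. x \<in> A \<Longrightarrow> w (f x) = v x"
  shows "finite_fibres (f ` A) w"
  using assms(1) by (simp add: finite_fibres_def fibre_image[of A w f v, OF assms(2)])

lemma class_gf_image:
  assumes "inj_on f A" "\<And>x. x \<in> A \<Longrightarrow> w (f x) = v x"
  shows "class_gf (f ` A) w = class_gf A v"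
proof (rule fps_ext)
  fix n
  have "inj_on f {x \<in> A. v x = n}"
    using assms(1) by (rule inj_on_subset) auto
  then show "fps_nth (class_gf (f ` A) w) n = fps_nth (class_gf A v) n"
    by (simp add: fibre_image[of A w f v, OF assms(2)] card_image)
qed

lemma class_gf_Suc: "class_gf A (\<lambda>x. Suc (w x)) = fps_X * class_gf A w"
proof (rule fps_ext)
  fix n show "fps_nth (class_gf A (\<lambda>x. Suc (w x))) n = fps_nth (fps_X * class_gf A w) n"
    by (cases n) auto
qed

lemma class_gf_singleton_zero: "w a = 0 \<Longrightarrow> class_gf {a} w = 1"
  by (rule fps_ext) (auto simp: Collect_conv_if)

lemma class_gf_Un_disjoint:
  assumes "finite_fibres A w" "finite_fibres B w" "A \<inter> B = {}"
  shows "class_gf (A \<union> B) w = class_gf A w + class_gf B w"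
proof (rule fps_ext)
  fix n
  have "{x \<in> A \<union> B. w x = n} = {x \<in> A. w x = n} \<union> {x \<in> B. w x = n}"
    by auto
  moreover have "{x \<in> A. w x = n} \<inter> {x \<in> B. w x = n} = {}"
    using assms(3) by auto
  ultimately show "fps_nth (class_gf (A \<union> B) w) n = fps_nth (class_gf A w + class_gf B w) n"
    using assms(1,2) by (simp add: finite_fibres_def card_Un_disjoint)
qed

text \<open>Sorting pairs by the weight of the first component mirrors the Cauchy product of
  series.\<close>

lemma fibre_Times:
  fixes w :: "'a \<Rightarrow> nat" and v :: "'b \<Rightarrow> nat"
  shows "{p \<in> A \<times> B. (\<lambda>(x, y). w x + v y) p = n} =
    (\<Union>i\<in>{0..n}. {x \<in> A. w x = i} \<times> {y \<in> B. v y = n - i})"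
  by auto

lemma finite_fibres_Times:
  assumes "finite_fibres A w" "finite_fibres B v"
  shows "finite_fibres (A \<times> B) (\<lambda>(x, y). w x + v y)"
  using assms unfolding finite_fibres_def fibre_Times by auto

lemma class_gf_Times:
  assumes "finite_fibres A w" "finite_fibres B v"
  shows "class_gf (A \<times> B) (\<lambda>(x, y). w x + v y) = class_gf A w * class_gf B v"
proof (rule fps_ext)
  fix n
  have "card (\<Union>i\<in>{0..n}. {x \<in> A. w x = i} \<times> {y \<in> B. v y = n - i}) =
      (\<Sum>i=0..n. card ({x \<in> A. w x = i} \<times> {y \<in> B. v y = n - i}))"
    using assms by (intro card_UN_disjoint) (auto simp: finite_fibres_def)
  then show "fps_nth (class_gf (A \<times> B) (\<lambda>(x, y). w x + v y)) n =
      fps_nth (class_gf A w * class_gf B v) n"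
    unfolding class_gf_nth fps_mult_nth fibre_Times by (simp add: card_cartesian_product)
qed

section \<open>Lists of structures, of fixed and of arbitrary length\<close>

lemma lists_length_Suc_conv_image:
  "{xs \<in> lists A. length xs = Suc b} =
    (\<lambda>(x, xs). x # xs) ` (A \<times> {xs \<in> lists A. length xs = b})"
  by (auto simp: image_iff length_Suc_conv)

text \<open>Both claims share one induction because the product rule needs finiteness for the
  shorter lists. With the length fixed, elements of weight 0 are harmless; a branch consisting of a
  single leaf will be one.\<close>

lemma class_gf_lists_length:
  assumes "finite_fibres A w"
  shows "finite_fibres {xs \<in> lists A. length xs = b} (\<lambda>xs. sum_list (map w xs)) \<and>
    class_gf {xs \<in> lists A. length xs = b} (\<lambda>xs. sum_list (map w xs)) = class_gf A w ^ b"
proof (induction b)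
  case 0
  have "{xs \<in> lists A. length xs = 0} = {[]}"
    by auto
  then show ?case
    by (simp add: class_gf_singleton_zero finite_fibres_def)
next
  case (Suc b)
  let ?v = "\<lambda>xs. sum_list (map w xs)"
  have "inj_on (\<lambda>(x, xs). x # xs) (A \<times> {xs \<in> lists A. length xs = b})"
    by (auto simp: inj_on_def)
  moreover have "?v ((\<lambda>(x, xs). x # xs) p) = (\<lambda>(x, xs). w x + ?v xs) p" for p
    by (cases p) simp
  ultimately show ?case
    unfolding lists_length_Suc_conv_image
    using Suc assms
    by (simp add: class_gf_image[where v = "\<lambda>(x, xs). w x + ?v xs"] class_gf_Times
        finite_fibres_image[where v = "\<lambda>(x, xs). w x + ?v xs"] finite_fibres_Times)
qed

lemma length_le_sum_list:
  fixes w :: "'a \<Rightarrow> nat"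
  assumes "\<And>x. x \<in> set xs \<Longrightarrow> w x > 0"
  shows "length xs \<le> sum_list (map w xs)"
  using assms
proof (induction xs)
  case (Cons x xs)
  then have "length xs \<le> sum_list (map w xs)" "w x > 0"
    by auto
  then show ?case
    by simp
qed simp

lemma finite_fibres_lists:
  assumes "finite_fibres A w" "\<And>x. x \<in> A \<Longrightarrow> w x > 0"
  shows "finite_fibres (lists A) (\<lambda>xs. sum_list (map w xs))"
  unfolding finite_fibres_def
proof
  fix n
  have "{x \<in> A. w x \<le> n} = (\<Union>i\<le>n. {x \<in> A. w x = i})"
    by auto
  then have "finite {x \<in> A. w x \<le> n}"
    using assms(1) by (simp add: finite_fibres_def)
  then have "finite {xs. set xs \<subseteq> {x \<in> A. w x \<le> n} \<and> length xs \<le> n}"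
    by (rule finite_lists_length_le)
  moreover have "{xs \<in> lists A. sum_list (map w xs) = n} \<subseteq>
      {xs. set xs \<subseteq> {x \<in> A. w x \<le> n} \<and> length xs \<le> n}"
    using assms(2) by (auto intro: member_le_sum_list length_le_sum_list)
  ultimately show "finite {xs \<in> lists A. sum_list (map w xs) = n}"
    by (rule rev_finite_subset)
qed

text \<open>A list is empty or a head followed by a list. Positive weights bound the length by the
  total weight, so only finitely many lists share a weight.\<close>

lemma class_gf_lists:
  assumes "finite_fibres A w" "\<And>x. x \<in> A \<Longrightarrow> w x > 0"
  defines "L \<equiv> class_gf (lists A) (\<lambda>xs. sum_list (map w xs))"
  shows "L = 1 + class_gf A w * L"
proof -
  let ?v = "\<lambda>xs. sum_list (map w xs)"
  let ?C = "(\<lambda>(x, xs). x # xs) ` (A \<times> lists A)"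
  have fin: "finite_fibres (lists A) ?v"
    using assms(1,2) by (rule finite_fibres_lists)
  have split: "lists A = {[]} \<union> ?C"
  proof (intro set_eqI)
    fix xs show "xs \<in> lists A \<longleftrightarrow> xs \<in> {[]} \<union> ?C"
      by (cases xs) auto
  qed
  have "L = class_gf ({[]} \<union> ?C) ?v"
    unfolding L_def by (subst (1) split) simp
  also have "\<dots> = class_gf {[]} ?v + class_gf ?C ?v"
  proof (rule class_gf_Un_disjoint)
    show "finite_fibres {[]} ?v" "finite_fibres ?C ?v"
      by (rule finite_fibres_subset[OF fin], force)+
  qed auto
  also have "class_gf ?C ?v = class_gf (A \<times> lists A) (\<lambda>(x, xs). w x + ?v xs)"
    by (rule class_gf_image) (auto simp: inj_on_def)
  also have "\<dots> = class_gf A w * L"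
    unfolding L_def using assms(1) fin by (rule class_gf_Times)
  finally show ?thesis
    by (simp add: class_gf_singleton_zero)
qed

section \<open>Nodes and branch leaves\<close>

primrec tree_size :: "plane_tree \<Rightarrow> nat" where
  "tree_size (Node ts) = Suc (sum_list (map tree_size ts))"

lemma tree_size_pos [simp]: "tree_size t > 0"
  by (cases t) simp

lemma nodes_Node: "nodes (Node ts) = insert [] (\<Union>i<length ts. (#) i ` nodes (ts ! i))"
  unfolding nodes_def by (auto elim: is_node.cases intro: is_node.intros simp: image_iff)

text \<open>Addresses below different children differ in their first entry, so the union is disjoint
  and cardinalities add up.\<close>

lemma finite_nodes_card: "finite (nodes t) \<and> card (nodes t) = tree_size t"
proof (induction t)
  case (Node ts)
  then have IH: "finite (nodes (ts ! i))" "card (nodes (ts ! i)) = tree_size (ts ! i)"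
    if "i < length ts" for i
    using that nth_mem by blast+
  have "card (\<Union>i<length ts. (#) i ` nodes (ts ! i)) =
      (\<Sum>i<length ts. card ((#) i ` nodes (ts ! i)))"
    by (rule card_UN_disjoint) (auto simp: IH)
  also have "\<dots> = (\<Sum>i<length ts. tree_size (ts ! i))"
    by (rule sum.cong) (simp_all add: card_image IH)
  also have "\<dots> = sum_list (map tree_size ts)"
    by (simp add: sum_list_sum_nth atLeast0LessThan)
  finally have "card (\<Union>i<length ts. (#) i ` nodes (ts ! i)) = sum_list (map tree_size ts)" .
  moreover have "finite (\<Union>i<length ts. (#) i ` nodes (ts ! i))"
    by (simp add: IH)
  ultimately show ?case
    unfolding nodes_Node by (subst card_insert_disjoint) auto
qed

lemma card_nodes [simp]: "card (nodes t) = tree_size t"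
  by (simp add: finite_nodes_card)

lemma rightmost_leaf_in_nodes: "rightmost_leaf t \<in> nodes t"
proof (induction t rule: rightmost_leaf.induct)
  case (1 ts)
  then show ?case
    by (cases "ts = []") (auto simp: nodes_Node last_conv_nth)
qed

lemma branch_leaves_Node:
  "branch_leaves (Node ts) = (\<lambda>i. i # rightmost_leaf (ts ! i)) ` {..<length ts}"
  by (auto simp: branch_leaves_def)

lemma card_branch_leaves [simp]: "card (branch_leaves (Node ts)) = length ts"
  by (simp add: branch_leaves_Node card_image inj_on_def)

lemma card_nodes_minus_branch_leaves:
  "card (nodes (Node ts) - branch_leaves (Node ts)) = tree_size (Node ts) - length ts"
proof -
  have "branch_leaves (Node ts) \<subseteq> nodes (Node ts)"
    by (auto simp: branch_leaves_Node nodes_Node rightmost_leaf_in_nodes)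
  moreover have "finite (branch_leaves (Node ts))"
    by (simp add: branch_leaves_Node)
  ultimately show ?thesis
    by (metis card_Diff_subset card_branch_leaves card_nodes)
qed

section \<open>Plane trees\<close>

text \<open>Induction on a bound rather than on the exact size: the children of a tree of size at
  most \<open>Suc n\<close> are at most \<open>n\<close> in number and each has size at most
  \<open>n\<close>, though their sizes may differ.\<close>

lemma finite_fibres_tree_size: "finite_fibres A tree_size"
proof -
  have "finite {t. tree_size t \<le> n}" for n
  proof (induction n)
    case 0
    then show ?case
      by (simp add: tree_size_pos[THEN less_imp_neq, symmetric])
  next
    case (Suc n)
    have "{t. tree_size t \<le> Suc n} \<subseteq>
        Node ` {ts. set ts \<subseteq> {t. tree_size t \<le> n} \<and> length ts \<le> n}"
    proof
      fix t assume t: "t \<in> {t. tree_size t \<le> Suc n}"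
      obtain ts where ts: "t = Node ts"
        by (cases t)
      with t have le: "sum_list (map tree_size ts) \<le> n"
        by simp
      have "length ts \<le> n"
        using length_le_sum_list[of ts tree_size] le by simp
      moreover have "tree_size u \<le> n" if "u \<in> set ts" for u
        using member_le_sum_list[of "tree_size u" "map tree_size ts"] that le by auto
      ultimately show "t \<in> Node ` {ts. set ts \<subseteq> {t. tree_size t \<le> n} \<and> length ts \<le> n}"
        using ts by auto
    qed
    then show ?case
      by (rule finite_subset) (intro finite_imageI finite_lists_length_le Suc)
  qed
  then show ?thesis
    unfolding finite_fibres_def by (fastforce intro: finite_subset[rotated])
qed

text \<open>Ordered forests, as found both below a root and to the left of a rightmost path.\<close>

definition forest_gf :: "real fps" where
  "forest_gf = class_gf UNIV (\<lambda>ts. sum_list (map tree_size ts))"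

lemma plane_tree_gf_forest: "class_gf UNIV tree_size = fps_X * forest_gf"
proof -
  have "(UNIV :: plane_tree set) = range Node"
    by (metis plane_tree.exhaust surj_def)
  then have "class_gf UNIV tree_size =
      class_gf UNIV (\<lambda>ts. Suc (sum_list (map tree_size ts)))"
    using class_gf_image[of Node UNIV tree_size] by (simp add: inj_on_def)
  then show ?thesis
    by (simp add: class_gf_Suc forest_gf_def)
qed

lemma plane_tree_gf_quadratic:
  "class_gf UNIV tree_size = fps_X + class_gf UNIV tree_size ^ 2"
proof -
  let ?T = "class_gf UNIV tree_size"
  have "forest_gf = 1 + ?T * forest_gf"
    using class_gf_lists[OF finite_fibres_tree_size[of UNIV]] by (simp add: forest_gf_def)
  then have "fps_X * forest_gf = fps_X + ?T * (fps_X * forest_gf)"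
    by (metis distrib_left mult.left_commute mult.right_neutral)
  then show ?thesis
    by (simp add: plane_tree_gf_forest[symmetric] power2_eq_square)
qed

text \<open>Completing the square in \<open>T = z + T^2\<close> makes \<open>1 - 2T\<close> a square
  root of \<open>1 - 4z\<close>. Its constant term is 1, as no tree is empty, and this singles out
  the root taken by \<open>fps_radical\<close>.\<close>

lemma T_gf_eq: "T_gf = class_gf UNIV tree_size"
proof -
  let ?T = "class_gf UNIV tree_size"
  let ?R = "1 - 2 * ?T"
  have T0: "fps_nth ?T 0 = 0"
    by (simp add: tree_size_pos[THEN less_imp_neq, symmetric])
  have "?R ^ 2 = 1 - 4 * (?T - ?T ^ 2)"
    by (simp add: power2_eq_square algebra_simps)
  also have "?T - ?T ^ 2 = fps_X"
    unfolding diff_eq_eq by (rule plane_tree_gf_quadratic)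
  finally have "?R ^ Suc 1 = 1 - 4 * fps_X"
    by (simp add: numeral_2_eq_2)
  then have "?R = fps_radical root (Suc 1) (1 - 4 * fps_X)"
    using radical_unique[of root 1 "1 - 4 * fps_X" ?R] T0 by simp
  then have "fps_radical root 2 (1 - 4 * fps_X) = ?R"
    by (simp add: numeral_2_eq_2)
  then have "T_gf = (2 * ?T) / 2"
    unfolding T_gf_def by simp
  then show ?thesis
    by simp
qed

lemma T_gf_quadratic: "T_gf = fps_X + T_gf ^ 2"
  unfolding T_gf_eq by (rule plane_tree_gf_quadratic)

lemma T_gf_nth_0: "fps_nth T_gf 0 = 0"
  by (simp add: T_gf_eq tree_size_pos[THEN less_imp_neq, symmetric])

section \<open>Catalan numbers as coefficients of \<open>T\<close>\<close>

lemma T_gf_deriv: "(1 - 4 * fps_X) * fps_deriv T_gf = 1 - 2 * T_gf"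
proof -
  \<comment> \<open>Differentiating \<open>T = z + T^2\<close> gives \<open>(1 - 2T) T' = 1\<close>;
    a further factor \<open>1 - 2T\<close> turns the left side into \<open>(1 - 4z) T'\<close>. The
    resulting equation is linear, hence a two-term recurrence for the coefficients.\<close>
  have "fps_deriv T_gf = 1 + 2 * T_gf * fps_deriv T_gf"
    by (subst (1) T_gf_quadratic) (simp add: power2_eq_square)
  then have d: "(1 - 2 * T_gf) * fps_deriv T_gf = 1"
    by (simp add: algebra_simps)
  have "(1 - 2 * T_gf) * (1 - 2 * T_gf) = 1 - 4 * (T_gf - T_gf ^ 2)"
    by (simp add: power2_eq_square algebra_simps)
  also have "T_gf - T_gf ^ 2 = fps_X"
    unfolding diff_eq_eq by (rule T_gf_quadratic)
  finally have "(1 - 4 * fps_X) * fps_deriv T_gf =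
      (1 - 2 * T_gf) * ((1 - 2 * T_gf) * fps_deriv T_gf)"
    by (simp add: mult.assoc)
  then show ?thesis
    by (simp add: d)
qed

lemma T_gf_nth_rec:
  "real (m + 2) * fps_nth T_gf (m + 2) = (4 * real m + 2) * fps_nth T_gf (m + 1)"
proof -
  have "fps_nth ((1 - 4 * fps_X) * fps_deriv T_gf) (Suc m) = fps_nth (1 - 2 * T_gf) (Suc m)"
    by (simp add: T_gf_deriv)
  then show ?thesis
    by (simp add: left_diff_distrib mult.assoc numeral_fps_const algebra_simps)
qed

text \<open>Two absorption steps, joined by the symmetry of row \<open>2m + 1\<close>. The factor is
  the one in the recurrence for the coefficients of \<open>T\<close>.\<close>

lemma central_binomial_rec:
  "real (Suc m) * real ((2 * Suc m) choose Suc m) = (4 * real m + 2) * real ((2 * m) choose m)"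
proof -
  have "Suc m * ((2 * Suc m) choose Suc m) = 2 * Suc m * (Suc (2 * m) choose m)"
    using Suc_times_binomial_eq[of "Suc (2 * m)" m] by (simp add: mult.commute)
  moreover have "Suc m * (Suc (2 * m) choose m) = Suc (2 * m) * ((2 * m) choose m)"
    using Suc_times_binomial_eq[of "2 * m" m] binomial_symmetric[of m "Suc (2 * m)"]
    by (simp add: mult.commute)
  ultimately have "Suc m * ((2 * Suc m) choose Suc m) = (4 * m + 2) * ((2 * m) choose m)"
    by (simp add: algebra_simps)
  then have "real (Suc m * ((2 * Suc m) choose Suc m)) = real ((4 * m + 2) * ((2 * m) choose m))"
    by (rule arg_cong)
  then show ?thesis
    by (simp only: of_nat_mult of_nat_add of_nat_numeral)
qed

lemma T_gf_nth_Suc: "fps_nth T_gf (Suc m) = real ((2 * m) choose m) / real (Suc m)"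
proof (induction m)
  case 0
  have "fps_nth T_gf 1 = fps_nth (fps_X + T_gf ^ 2) 1"
    by (rule arg_cong[OF T_gf_quadratic])
  then show ?case
    by (simp add: power2_eq_square fps_mult_nth T_gf_nth_0)
next
  case (Suc m)
  have "real (m + 2) * fps_nth T_gf (m + 2) =
      (4 * real m + 2) * real ((2 * m) choose m) / real (Suc m)"
    using T_gf_nth_rec[of m] Suc by simp
  also have "\<dots> = real ((2 * Suc m) choose Suc m)"
    using central_binomial_rec[of m] by (simp add: field_simps del: binomial_Suc_Suc)
  finally show ?case
    by (simp add: field_simps del: binomial_Suc_Suc)
qed

section \<open>Branches\<close>

text \<open>The root of a branch lies at distance 1 from the root of the whole tree, so odd distance
  becomes even depth inside the branch.\<close>

definition even_trees :: "plane_tree set" where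
  "even_trees = {t. even (length (rightmost_leaf t))}"

text \<open>The subtracted node is the rightmost leaf, which \<open>t\<close> marks instead of
  \<open>z\<close>.\<close>

definition branch_gf :: "plane_tree set \<Rightarrow> real fps" where
  "branch_gf A = class_gf A (\<lambda>t. tree_size t - 1)"

lemma finite_fibres_tree_size_minus: "finite_fibres A (\<lambda>t. tree_size t - 1)"
proof -
  have "{t \<in> A. tree_size t - 1 = n} = {t \<in> A. tree_size t = Suc n}" for n
    using tree_size_pos by (auto simp: Suc_diff_1)
  then show ?thesis
    using finite_fibres_tree_size by (simp add: finite_fibres_def)
qed

definition graft_right :: "plane_tree list \<times> plane_tree \<Rightarrow> plane_tree" where
  "graft_right = (\<lambda>(ts, u). Node (ts @ [u]))"

text \<open>The rightmost leaf of the last child remains the rightmost leaf and stays uncounted. The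
  new root and the forest on its left contribute \<open>z * forest_gf = T\<close>.\<close>

lemma branch_gf_graft_right: "branch_gf (graft_right ` (UNIV \<times> B)) = T_gf * branch_gf B"
proof -
  let ?v = "\<lambda>ts. sum_list (map tree_size ts)"
  have "branch_gf (graft_right ` (UNIV \<times> B)) =
      class_gf (UNIV \<times> B) (\<lambda>p. Suc ((\<lambda>(ts, u). ?v ts + (tree_size u - 1)) p))"
    unfolding branch_gf_def
    by (rule class_gf_image) (auto simp: graft_right_def inj_on_def Suc_diff_1)
  also have "\<dots> = fps_X * (forest_gf * branch_gf B)"
    unfolding class_gf_Suc forest_gf_def branch_gf_def
    using finite_fibres_lists[OF finite_fibres_tree_size[of UNIV]]
    by (subst class_gf_Times) (simp_all add: finite_fibres_tree_size_minus del: One_nat_def)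
  finally show ?thesis
    by (simp add: T_gf_eq plane_tree_gf_forest mult.assoc)
qed

lemma plane_tree_cases_right:
  obtains "t = Node []" | ts u where "t = graft_right (ts, u)"
  by (metis case_prod_conv graft_right_def plane_tree.exhaust rev_exhaust)

lemma graft_right_inject [simp]: "graft_right (ts, u) = graft_right (ts', u') \<longleftrightarrow> ts = ts' \<and> u = u'"
  by (simp add: graft_right_def)

lemma graft_right_neq_leaf [simp]: "graft_right p \<noteq> Node []" "Node [] \<noteq> graft_right p"
  by (auto simp: graft_right_def split: prod.splits)

lemma length_rightmost_leaf_graft_right [simp]:
  "length (rightmost_leaf (graft_right (ts, u))) = Suc (length (rightmost_leaf u))"
  by (simp add: graft_right_def)

text \<open>Grafting lengthens the rightmost path by one edge and so flips its parity; the single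
  node, with a path of length 0, is even.\<close>

lemma odd_trees_conv_graft: "- even_trees = graft_right ` (UNIV \<times> even_trees)"
proof (intro set_eqI)
  fix t show "t \<in> - even_trees \<longleftrightarrow> t \<in> graft_right ` (UNIV \<times> even_trees)"
    by (cases t rule: plane_tree_cases_right) (auto simp: even_trees_def)
qed

lemma even_trees_conv_graft: "even_trees = {Node []} \<union> graft_right ` (UNIV \<times> - even_trees)"
proof (intro set_eqI)
  fix t show "t \<in> even_trees \<longleftrightarrow> t \<in> {Node []} \<union> graft_right ` (UNIV \<times> - even_trees)"
    by (cases t rule: plane_tree_cases_right) (auto simp: even_trees_def)
qed

text \<open>Writing \<open>E\<close> and \<open>O\<close> for the even and odd classes, the
  decompositions read \<open>E = 1 + T O\<close> and \<open>O = T E\<close>; eliminating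
  \<open>O\<close> leaves \<open>E = 1 + T^2 E\<close>.\<close>

lemma branch_gf_even_trees: "branch_gf even_trees * (1 - T_gf ^ 2) = 1"
proof -
  have "branch_gf even_trees = branch_gf ({Node []} \<union> graft_right ` (UNIV \<times> - even_trees))"
    by (rule arg_cong[OF even_trees_conv_graft])
  also have "\<dots> = branch_gf {Node []} + branch_gf (graft_right ` (UNIV \<times> - even_trees))"
    unfolding branch_gf_def
    by (rule class_gf_Un_disjoint)
      (auto simp: finite_fibres_tree_size_minus graft_right_def simp del: One_nat_def)
  also have "\<dots> = 1 + T_gf * branch_gf (- even_trees)"
    by (simp add: branch_gf_graft_right) (simp add: branch_gf_def class_gf_singleton_zero)
  also have "branch_gf (- even_trees) = T_gf * branch_gf even_trees"
    by (simp add: odd_trees_conv_graft branch_gf_graft_right)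
  finally show ?thesis
    by (simp add: algebra_simps power2_eq_square)
qed

section \<open>Catalan--Stanley trees\<close>

lemma catalan_stanley_Node [simp]: "catalan_stanley (Node ts) \<longleftrightarrow> ts \<in> lists even_trees"
proof -
  have "catalan_stanley (Node ts) \<longleftrightarrow> (\<forall>i<length ts. ts ! i \<in> even_trees)"
    by (auto simp: catalan_stanley_def branch_leaves_Node even_trees_def)
  then show ?thesis
    by (simp add: in_lists_conv_set all_set_conv_all_nth)
qed

text \<open>Removing one leaf per branch leaves the root, which accounts for the
  \<open>Suc\<close>.\<close>

lemma tree_size_minus_length:
  "tree_size (Node ts) - length ts = Suc (sum_list (map (\<lambda>t. tree_size t - 1) ts))"
proof -
  have "sum_list (map tree_size ts) = sum_list (map (\<lambda>t. tree_size t - 1) ts) + length ts"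
    by (induction ts) (auto simp: Suc_diff_1)
  then show ?thesis
    by simp
qed

lemma S_gf_nth: "fps_nth S_gf b = fps_X * branch_gf even_trees ^ b"
proof -
  let ?w = "\<lambda>\<tau>. card (nodes \<tau> - branch_leaves \<tau>)"
  let ?L = "{ts \<in> lists even_trees. length ts = b}"
  have "{\<tau>. catalan_stanley \<tau> \<and> card (branch_leaves \<tau>) = b \<and> ?w \<tau> = a} =
      {\<tau> \<in> Node ` ?L. ?w \<tau> = a}" for a
  proof (intro set_eqI)
    fix \<tau>
    show "\<tau> \<in> {\<tau>. catalan_stanley \<tau> \<and> card (branch_leaves \<tau>) = b \<and> ?w \<tau> = a} \<longleftrightarrow>
        \<tau> \<in> {\<tau> \<in> Node ` ?L. ?w \<tau> = a}"
      by (cases \<tau>) auto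
  qed
  then have "fps_nth S_gf b = class_gf (Node ` ?L) ?w"
    by (simp add: S_gf_def class_gf_def)
  also have "\<dots> = class_gf ?L (\<lambda>ts. Suc (sum_list (map (\<lambda>t. tree_size t - 1) ts)))"
    by (rule class_gf_image)
      (simp_all only: inj_on_def plane_tree.inject card_nodes_minus_branch_leaves
        tree_size_minus_length, simp)
  also have "\<dots> = fps_X * branch_gf even_trees ^ b"
    unfolding branch_gf_def class_gf_Suc
    by (simp only: class_gf_lists_length[OF finite_fibres_tree_size_minus])
  finally show ?thesis .
qed

lemma eq_times_right_inverse:
  fixes x y z w :: "'a::monoid_mult"
  assumes "x * y = z" "y * w = 1"
  shows "x = z * w"
  using assms by (auto simp: mult.assoc)

text \<open>The series \<open>z E^b\<close> is geometric in \<open>b\<close>. Clearing the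
  denominator lets the identity be checked one power of \<open>t\<close> at a time.\<close>

lemma S_gf_closed_form: "S_gf = var_z + var_z * var_t / (1 - var_t - fps_const T_gf ^ 2)"
proof -
  let ?D = "1 - var_t - fps_const T_gf ^ 2 :: real fps fps"
  let ?E = "branch_gf even_trees"
  \<comment> \<open>In this form multiplication by \<open>?D\<close> is scaling by
    \<open>1 - T^2\<close> minus a shift in \<open>t\<close>.\<close>
  have D: "?D = fps_const (1 - T_gf ^ 2) - var_t"
    by (simp add: fps_const_power fps_const_sub[symmetric])
  have D0: "fps_nth ?D 0 = 1 - T_gf ^ 2"
    by (simp add: fps_const_power)
  have "(S_gf - var_z) * ?D = var_z * var_t"
  proof (rule fps_ext)
    fix b
    have step: "fps_X * ?E ^ Suc c * (1 - T_gf ^ 2) = fps_X * ?E ^ c" for c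
      using branch_gf_even_trees by (simp add: mult.assoc mult.left_commute[of ?E])
    have "fps_nth ((S_gf - var_z) * ?D) b =
        fps_nth (S_gf - var_z) b * (1 - T_gf ^ 2) -
        (if b = 0 then 0 else fps_nth (S_gf - var_z) (b - 1))"
      unfolding D right_diff_distrib[of "S_gf - var_z"] fps_sub_nth[of "(S_gf - var_z) * _"]
        fps_mult_right_const_nth fps_X_mult_right_nth by (rule refl)
    also have "\<dots> = fps_nth (var_z * var_t) b"
    proof (cases b)
      case 0
      then show ?thesis
        by (simp add: S_gf_nth)
    next
      case (Suc c)
      then show ?thesis
        \<comment> \<open>At \<open>t^1\<close> the shifted term vanishes, since
          \<open>S - z\<close> has no constant term in \<open>t\<close>, and \<open>z\<close>
          remains; at higher powers the two terms cancel.\<close>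
        by (cases c) (simp_all add: S_gf_nth step branch_gf_even_trees del: power_Suc)
    qed
    finally show "fps_nth ((S_gf - var_z) * ?D) b = fps_nth (var_z * var_t) b" .
  qed
  \<comment> \<open>The coefficients are themselves series, not field elements, so invertibility is
    needed on two levels: \<open>1 - T^2\<close> has constant term 1 in \<open>z\<close>, hence is a
    unit, hence so is \<open>?D\<close>.\<close>
  moreover have "?D * inverse ?D = 1"
  proof -
    have "fps_nth (1 - T_gf ^ 2) 0 \<noteq> 0"
      by (simp add: power2_eq_square T_gf_nth_0)
    then have "fps_nth ?D 0 * inverse (fps_nth ?D 0) = 1"
      unfolding D0 by (rule inverse_mult_eq_1')
    then show ?thesis
      unfolding fps_inverse_def by (rule fps_right_inverse)
  qed
  ultimately have "S_gf - var_z = var_z * var_t * inverse ?D"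
    by (rule eq_times_right_inverse)
  moreover have "fps_nth ?D 0 \<noteq> 0"
    unfolding D0 using branch_gf_even_trees by auto
  then have "var_z * var_t / ?D = var_z * var_t * inverse ?D"
    by (intro fps_divide_unit' subdegree_eq_0)
  ultimately have "S_gf - var_z = var_z * var_t / ?D"
    by (rule trans[OF _ sym])
  then have "S_gf = var_z * var_t / ?D + var_z"
    by (rule diff_eq_eq[THEN iffD1])
  then show ?thesis
    by (rule trans[OF _ add.commute])
qed

lemma catalan_stanley_class_gf: "class_gf {\<tau>. catalan_stanley \<tau>} tree_size = fps_X * (1 + T_gf)"
proof -
  let ?E = "branch_gf even_trees"
  let ?v = "\<lambda>ts. sum_list (map tree_size ts)"
  define L where "L = class_gf (lists even_trees) ?v"
  have CS: "{\<tau>. catalan_stanley \<tau>} = Node ` lists even_trees"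
  proof (intro set_eqI)
    fix \<tau> show "\<tau> \<in> {\<tau>. catalan_stanley \<tau>} \<longleftrightarrow> \<tau> \<in> Node ` lists even_trees"
      by (cases \<tau>) auto
  qed
  have "class_gf {\<tau>. catalan_stanley \<tau>} tree_size = class_gf (lists even_trees) (\<lambda>ts. Suc (?v ts))"
    unfolding CS by (rule class_gf_image) (auto simp: inj_on_def)
  then have C: "class_gf {\<tau>. catalan_stanley \<tau>} tree_size = fps_X * L"
    by (simp add: class_gf_Suc L_def)
  \<comment> \<open>Here all nodes count alike, so the marked leaf returns as a factor
    \<open>z\<close>.\<close>
  have "class_gf even_trees tree_size = class_gf even_trees (\<lambda>t. Suc (tree_size t - 1))"
    by (rule class_gf_cong) (simp add: Suc_diff_1)
  then have "class_gf even_trees tree_size = fps_X * ?E"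
    by (simp only: class_gf_Suc branch_gf_def)
  then have "L = 1 + fps_X * ?E * L"
    using class_gf_lists[OF finite_fibres_tree_size[of even_trees]] by (simp add: L_def)
  \<comment> \<open>Multiplying by \<open>1 - T^2\<close> removes \<open>E\<close>; then
    \<open>z + T^2 = T\<close> exposes a common factor \<open>1 - T\<close>, which is nonzero and
    cancels.\<close>
  then have "L * (1 - T_gf ^ 2) = (1 - T_gf ^ 2) + fps_X * (?E * (1 - T_gf ^ 2)) * L"
    by (metis (no_types, opaque_lifting) distrib_right mult.assoc mult.commute mult_1)
  then have "L * (1 - (fps_X + T_gf ^ 2)) = 1 - T_gf ^ 2"
    unfolding branch_gf_even_trees by (simp add: algebra_simps)
  then have "L * (1 - T_gf) = (1 + T_gf) * (1 - T_gf)"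
    unfolding T_gf_quadratic[symmetric] by (simp add: algebra_simps power2_eq_square)
  moreover have "fps_nth (1 - T_gf) 0 \<noteq> 0"
    by (simp add: T_gf_nth_0)
  then have "1 - T_gf \<noteq> 0"
    by (metis fps_zero_nth)
  ultimately show ?thesis
    using C by simp
qed

theorem mainTheorem1:
  shows "S_gf = var_z + var_z * var_t / (1 - var_t - fps_const T_gf ^ 2) \<and>
    card {\<tau>. catalan_stanley \<tau> \<and> card (nodes \<tau>) = 1} = 1 \<and>
    (\<forall>n::nat. n \<ge> 2 \<longrightarrow>
       real (card {\<tau>. catalan_stanley \<tau> \<and> card (nodes \<tau>) = n}) =
         1 / (real n - 1) * real ((2 * n - 4) choose (n - 2)))"
proof (intro conjI allI impI)
  have count: "real (card {\<tau>. catalan_stanley \<tau> \<and> card (nodes \<tau>) = n}) =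
      fps_nth (fps_X * (1 + T_gf)) n" for n
    unfolding catalan_stanley_class_gf[symmetric] by simp
  show "S_gf = var_z + var_z * var_t / (1 - var_t - fps_const T_gf ^ 2)"
    by (rule S_gf_closed_form)
  have "real (card {\<tau>. catalan_stanley \<tau> \<and> card (nodes \<tau>) = 1}) = 1"
    unfolding count by (simp add: T_gf_nth_0)
  then show "card {\<tau>. catalan_stanley \<tau> \<and> card (nodes \<tau>) = 1} = 1"
    by linarith
  fix n :: nat
  assume "n \<ge> 2"
  \<comment> \<open>The coefficient of \<open>z (1 + T)\<close> at \<open>m + 2\<close> is that of
    \<open>T\<close> at \<open>m + 1\<close>, the Catalan number with index
    \<open>m = n - 2\<close>.\<close>
  then obtain m where n: "n = Suc (Suc m)"
    by (metis add_2_eq_Suc le_Suc_ex)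
  then show "real (card {\<tau>. catalan_stanley \<tau> \<and> card (nodes \<tau>) = n}) =
      1 / (real n - 1) * real ((2 * n - 4) choose (n - 2))"
    unfolding count by (simp add: T_gf_nth_Suc)
qed

end
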